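(* Let $T$ be a tree and let $S\subseteq V(T)$ be nonempty. Then $S$ is a mutual-visibility set of $T$ if and only if $S$ is precisely the leaf set of the Steiner subtree $T\langle S\rangle$, i.e. $S=\mathcal{L}(T\langle S\rangle)$.
   Context: All graphs are simple, undirected and connected. For a graph $G$ and $X\subseteq V(G)$, two vertices $u,v$ are $X$-visible if there is a shortest path between $u$ and $v$ in $G$ whose internal vertices all lie outside $X$. A set $X\subseteq V(G)$ is a mutual-visibility set of $G$ if every pair of vertices of $X$ is $X$-visible. A tree is a connected graph with no cycles. In a tree, a leaf is a vertex of degree one, and $\mathcal{L}(T')$ denotes the set of all leaves of a tree $T'$. For a tree $T$ and a nonempty set $S\subseteq V(T)$, the Steiner subtree $T\langle S\rangle$ is the unique connected subgraph of $T$ that contains all vertices of $S$ and is minimal by inclusion (no proper subgraph of it is connected and still contains $S$); equivalently, it is the unique subtree of $T$ containing $S$ with the minimum number of edges.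
   Formalization: The only vertex of a one-vertex tree (degree zero) is counted as a leaf; with leaves only of degree one the claim fails when S is a single vertex, since S is then a mutual-visibility set but its Steiner subtree has no leaf. *)

theory Defs
  imports "Graph_Theory.Digraph_Component" "Graph_Theory.Digraph_Component_Vwalk"
    "Graph_Theory.Pair_Digraph"
begin

text \<open>
  Simple undirected graphs are the symmetric, loop-free pair digraphs
  (\<^locale>\<open>pair_bidirected_digraph\<close>); an undirected edge is represented by its two opposite arcs.
  Finiteness is nowhere assumed.
\<close>

definition shortest_path :: "'a pair_pre_digraph \<Rightarrow> 'a \<Rightarrow> 'a list \<Rightarrow> 'a \<Rightarrow> bool" where
  "shortest_path G u p v \<longleftrightarrow>
     vpath p (with_proj G) \<and> hd p = u \<and> last p = v \<and>
     (\<forall>q. vpath q (with_proj G) \<and> hd q = u \<and> last q = v \<longrightarrow> vwalk_length p \<le> vwalk_length q)"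

text \<open>Deleting the first and the last entry of a path leaves its internal vertices.\<close>

definition visible :: "'a pair_pre_digraph \<Rightarrow> 'a set \<Rightarrow> 'a \<Rightarrow> 'a \<Rightarrow> bool" where
  "visible G X u v \<longleftrightarrow> (\<exists>p. shortest_path G u p v \<and> set (butlast (tl p)) \<inter> X = {})"

definition mutual_visibility_set :: "'a pair_pre_digraph \<Rightarrow> 'a set \<Rightarrow> bool" where
  "mutual_visibility_set G X \<longleftrightarrow>
     X \<subseteq> pverts G \<and> (\<forall>u\<in>X. \<forall>v\<in>X. visible G X u v)"

text \<open>
  The library constants \<^const>\<open>pre_digraph.cycle\<close> and \<^const>\<open>tree\<close> do not fit here: they count
  \<open>a, b, a\<close> as a cycle, so a symmetric digraph with an edge is never a \<^const>\<open>tree\<close>.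
  A cycle of an undirected graph has at least three edges.
\<close>

definition undirected_cycle :: "'a pair_pre_digraph \<Rightarrow> 'a list \<Rightarrow> bool" where
  "undirected_cycle G c \<longleftrightarrow>
     vwalk c (with_proj G) \<and> hd c = last c \<and> distinct (tl c) \<and> 3 \<le> vwalk_length c"

definition undirected_tree :: "'a pair_pre_digraph \<Rightarrow> bool" where
  "undirected_tree T \<longleftrightarrow>
     pair_bidirected_digraph T \<and> connected (with_proj T) \<and> (\<nexists>c. undirected_cycle T c)"

text \<open>
  In a symmetric digraph the out-degree is the degree of the underlying undirected graph.
  A leaf is a vertex of degree one; by convention the only vertex of a one-vertex tree, which has
  degree zero, is also a leaf.
\<close>

definition leaves :: "'a pair_pre_digraph \<Rightarrow> 'a set" where
  "leaves T = {v \<in> pverts T. out_degree (with_proj T) v = 1 \<or> pverts T = {v}}"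

lemma leaves_eq_degree_one:
  assumes "u \<in> pverts T" "v \<in> pverts T" "u \<noteq> v"
  shows "leaves T = {w \<in> pverts T. out_degree (with_proj T) w = 1}"
  using assms by (auto simp: leaves_def)

definition connected_subgraph_containing ::
    "'a pair_pre_digraph \<Rightarrow> 'a set \<Rightarrow> 'a pair_pre_digraph \<Rightarrow> bool" where
  "connected_subgraph_containing T S H \<longleftrightarrow>
     pair_bidirected_digraph H \<and> subgraph (with_proj H) (with_proj T) \<and>
     connected (with_proj H) \<and> S \<subseteq> pverts H"

definition is_steiner_subtree ::
    "'a pair_pre_digraph \<Rightarrow> 'a set \<Rightarrow> 'a pair_pre_digraph \<Rightarrow> bool" where
  "is_steiner_subtree T S H \<longleftrightarrow>
     connected_subgraph_containing T S H \<and>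
     (\<forall>H'. connected_subgraph_containing T S H' \<and> subgraph (with_proj H') (with_proj H)
        \<longrightarrow> H' = H)"

definition steiner_subtree :: "'a pair_pre_digraph \<Rightarrow> 'a set \<Rightarrow> 'a pair_pre_digraph" where
  "steiner_subtree T S = (THE H. is_steiner_subtree T S H)"

end

theory Submission
  imports Defs
begin

text \<open>
  In a tree the path between two vertices is unique, so the Steiner subtree of \<open>S\<close> is the union
  of all paths with both ends in \<open>S\<close>, and \<open>S\<close> is a mutual-visibility set iff no such path has an
  internal vertex in \<open>S\<close>. An internal vertex of such a path has two neighbours in the union, so
  it is not a leaf; hence every leaf lies in \<open>S\<close>, and \<open>S\<close> is a mutual-visibility set
  if all its elements are leaves. Conversely, suppose \<open>v \<in> S\<close> is internal to no such path. Then every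
  edge of the union at \<open>v\<close> starts a path from \<open>v\<close> to a vertex of \<open>S\<close>; two different edges would give
  two paths that meet only in \<open>v\<close>, and joining them would make \<open>v\<close> internal.
\<close>

section \<open>Vertex walks and subgraphs\<close>

lemma vwalk_append_iff:
  assumes "p \<noteq> []" "q \<noteq> []"
  shows "vwalk (p @ q) G \<longleftrightarrow> vwalk p G \<and> vwalk q G \<and> (last p, hd q) \<in> arcs_ends G"
  using assms by (auto simp: vwalk_def vwalk_arcs_append)

text \<open>Locates an arc on a walk, so that the vertices before and after it can be
  discussed.\<close>

lemma in_set_vwalk_arcs_iff: "(a, b) \<in> set (vwalk_arcs p) \<longleftrightarrow> (\<exists>xs ys. p = xs @ a # b # ys)"
proof
  show "\<exists>xs ys. p = xs @ a # b # ys" if "(a, b) \<in> set (vwalk_arcs p)"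
    using that
  proof (induct p rule: vwalk_arcs.induct)
    case (3 x y zs)
    show ?case
    proof (cases "(a, b) = (x, y)")
      case True
      then show ?thesis by (metis append_Nil prod.inject)
    next
      case False
      with 3 obtain xs ys where "y # zs = xs @ a # b # ys" by auto
      then have "x # y # zs = (x # xs) @ a # b # ys" by simp
      then show ?thesis by blast
    qed
  qed auto
next
  assume "\<exists>xs ys. p = xs @ a # b # ys"
  then show "(a, b) \<in> set (vwalk_arcs p)"
    by (auto intro: in_set_vwalk_arcs_append1)
qed

lemma vpath_rev:
  assumes "symmetric G" "vpath p G"
  shows "vpath (rev p) G"
  using assms by (simp add: vpath_def vwalk_rev_ex)

lemma subgraph_with_proj_antisym:
  assumes "subgraph (with_proj G) (with_proj H)" "subgraph (with_proj H) (with_proj G)"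
  shows "G = H"
  using assms by (intro pair_pre_digraph.equality) (auto simp: subgraph_def)

section \<open>Paths in trees\<close>

locale undirected_tree_graph =
  fixes T :: "'a pair_pre_digraph"
  assumes undirected_tree: "undirected_tree T"
begin

sublocale pair_bidirected_digraph T
  using undirected_tree by (simp add: undirected_tree_def)

lemma ex_vpath:
  assumes "u \<in> pverts T" "v \<in> pverts T"
  obtains p where "vpath p (with_proj T)" "hd p = u" "last p = v"
proof -
  have "strongly_connected (with_proj T)"
    using symmetric_connected_imp_strongly_connected[OF sym_arcs] undirected_tree
    by (auto simp: undirected_tree_def)
  then have "u \<rightarrow>\<^sup>*\<^bsub>with_proj T\<^esub> v"
    using assms by (auto simp: strongly_connected_def)
  then show ?thesis
    using that by (auto simp: reachable_vpath_conv)
qed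

text \<open>Otherwise, following the first path to its first vertex \<open>z\<close> on the second
  and returning along the second to \<open>u\<close> would close a cycle.\<close>

lemma diverging_paths_meet_only_at_start:
  assumes "vpath (u # p) (with_proj T)" "vpath (u # q) (with_proj T)"
    and "p \<noteq> []" "q \<noteq> []" "hd p \<noteq> hd q"
  shows "set p \<inter> set q = {}"
proof (rule ccontr)
  assume "set p \<inter> set q \<noteq> {}"
  then have "\<exists>x\<in>set p. x \<in> set q" by blast
  then obtain p1 z p2 where p: "p = p1 @ z # p2" and z: "z \<in> set q"
    and p1: "\<forall>x\<in>set p1. x \<notin> set q"
    by (rule split_list_first_propE) blast
  from z obtain q1 q2 where q: "q = q1 @ z # q2" by (meson split_list)
  let ?c = "(u # p1 @ [z]) @ rev (u # q1)"
  have walks: "vwalk (u # p1 @ [z]) (with_proj T)" "vwalk (u # q1) (with_proj T)"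
    and arc: "(last (u # q1), z) \<in> parcs T"
  proof -
    have "vwalk ((u # p1 @ [z]) @ p2) (with_proj T)"
      using assms(1) p by auto
    then show "vwalk (u # p1 @ [z]) (with_proj T)"
      by (rule vwalkI_append_l[rotated]) simp
    have "vwalk ((u # q1) @ z # q2) (with_proj T)"
      using assms(2) q by auto
    then have "vwalk (u # q1) (with_proj T) \<and> (last (u # q1), hd (z # q2)) \<in> parcs T"
      by (subst (asm) vwalk_append_iff) simp_all
    then show "vwalk (u # q1) (with_proj T)" "(last (u # q1), z) \<in> parcs T"
      by simp_all
  qed
  have "vwalk ?c (with_proj T)"
    using walks arc arcs_symmetric vwalk_rev_ex[OF sym_arcs walks(2)]
    by (subst vwalk_append_iff) (auto simp: hd_append hd_rev)
  moreover have "distinct (tl ?c)"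
    using assms(1,2) p q p1 by (auto simp: vpath_def)
  \<comment> \<open>If both were empty, both paths would continue from \<open>u\<close> to
    \<open>z\<close>. The closed walk has \<open>2 + length p1 + length q1\<close> arcs, so one
    extra vertex gives the required three.\<close>
  moreover have "p1 \<noteq> [] \<or> q1 \<noteq> []"
    using assms(5) p q by auto
  then have "3 \<le> vwalk_length ?c"
    by (cases p1; cases q1) auto
  ultimately have "undirected_cycle T ?c"
    by (auto simp: undirected_cycle_def)
  then show False
    using undirected_tree by (auto simp: undirected_tree_def)
qed

text \<open>Induction along \<open>p\<close>: after the common start, two nonempty tails share their
  last vertex, so they cannot diverge and must begin with the same vertex.\<close>

lemma vpath_unique:
  assumes "vpath p (with_proj T)" "vpath q (with_proj T)" "hd p = hd q" "last p = last q"
  shows "p = q"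
  using assms
proof (induct p arbitrary: q)
  case (Cons u p q')
  then obtain q where q': "q' = u # q"
    by (cases q') (auto simp: vpath_def vwalk_def)
  show ?case
  proof (cases "p = [] \<or> q = []")
    \<comment> \<open>One path is just \<open>[u]\<close>, so the other also ends in
      \<open>u\<close>; distinctness leaves it no further vertices.\<close>
    case True
    then show ?thesis
      using Cons.prems q' last_in_set[of p] last_in_set[of q]
      by (cases "p = []"; cases "q = []") (auto simp: vpath_def)
  next
    case False
    then have "last p = last q"
      using Cons.prems(4) q' by simp
    then have "last p \<in> set p" "last p \<in> set q"
      using False last_in_set[of p] last_in_set[of q] by metis+
    then have "hd p = hd q"
      using diverging_paths_meet_only_at_start[of u p q] False Cons.prems(1,2) q' by blast
    moreover have "vpath p (with_proj T)" "vpath q (with_proj T)"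
      using False Cons.prems q' by (auto simp: vpath_def elim: vwalk_consE)
    ultimately show ?thesis
      using Cons.hyps[of q] Cons.prems q' False by auto
  qed
qed (auto simp: vpath_def vwalk_def)

lemma shortest_path_iff:
  "shortest_path T u p v \<longleftrightarrow> vpath p (with_proj T) \<and> hd p = u \<and> last p = v"
  unfolding shortest_path_def using vpath_unique by (metis order_refl)

section \<open>The Steiner subtree as a union of paths\<close>

definition terminal_paths :: "'a set \<Rightarrow> 'a list set" where
  "terminal_paths S = {p. vpath p (with_proj T) \<and> hd p \<in> S \<and> last p \<in> S}"

text \<open>Each path contributes its arcs in one direction only; the opposite arcs come from the
  reversed path, which is terminal too. One-vertex paths put \<open>S\<close> itself among the
  vertices.\<close>

definition path_hull :: "'a set \<Rightarrow> 'a pair_pre_digraph" where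
  "path_hull S =
     \<lparr>pverts = (\<Union>p\<in>terminal_paths S. set p), parcs = (\<Union>p\<in>terminal_paths S. set (vwalk_arcs p))\<rparr>"

lemma path_hull_simps [simp]:
  "pverts (path_hull S) = (\<Union>p\<in>terminal_paths S. set p)"
  "parcs (path_hull S) = (\<Union>p\<in>terminal_paths S. set (vwalk_arcs p))"
  by (simp_all add: path_hull_def)

text \<open>Since the path between two terminals is unique, "some shortest path avoids
  \<open>S\<close>" turns into "every terminal path avoids \<open>S\<close> internally".\<close>

lemma mutual_visibility_set_iff:
  assumes "S \<subseteq> pverts T"
  shows "mutual_visibility_set T S \<longleftrightarrow> (\<forall>p\<in>terminal_paths S. set (butlast (tl p)) \<inter> S = {})"
proof
  assume vis: "mutual_visibility_set T S"
  show "\<forall>p\<in>terminal_paths S. set (butlast (tl p)) \<inter> S = {}"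
  proof
    fix p assume p: "p \<in> terminal_paths S"
    then have "visible T S (hd p) (last p)"
      using vis by (auto simp: mutual_visibility_set_def terminal_paths_def)
    then obtain q where "vpath q (with_proj T)" "hd q = hd p" "last q = last p"
      "set (butlast (tl q)) \<inter> S = {}"
      by (auto simp: visible_def shortest_path_iff)
    with p vpath_unique[of q p] show "set (butlast (tl p)) \<inter> S = {}"
      by (auto simp: terminal_paths_def)
  qed
next
  assume free: "\<forall>p\<in>terminal_paths S. set (butlast (tl p)) \<inter> S = {}"
  have "visible T S u v" if uv: "u \<in> S" "v \<in> S" for u v
  proof -
    obtain p where "vpath p (with_proj T)" "hd p = u" "last p = v"
      using ex_vpath[of u v] assms uv by blast
    then show ?thesis
      using free uv by (auto simp: visible_def shortest_path_iff terminal_paths_def)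
  qed
  then show "mutual_visibility_set T S"
    using assms by (simp add: mutual_visibility_set_def)
qed

lemma singleton_terminal_path:
  assumes "S \<subseteq> pverts T" "v \<in> S"
  shows "[v] \<in> terminal_paths S"
  using assms by (auto simp: terminal_paths_def vpath_def)

lemma terminal_paths_rev:
  assumes "p \<in> terminal_paths S"
  shows "rev p \<in> terminal_paths S"
  using assms vpath_rev[OF sym_arcs, of p] by (auto simp: terminal_paths_def hd_rev last_rev)

lemma pair_bidirected_digraph_path_hull: "pair_bidirected_digraph (path_hull S)"
proof
  show "fst e \<in> pverts (path_hull S)" "snd e \<in> pverts (path_hull S)"
    if "e \<in> parcs (path_hull S)" for e
    using that arcs_in_vwalk_arcs[of e] by fastforce+
  show "symmetric (with_proj (path_hull S))"
    unfolding symmetric_def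
  proof (rule symI)
    fix a b assume "(a, b) \<in> arcs_ends (with_proj (path_hull S))"
    then obtain p where "p \<in> terminal_paths S" "(a, b) \<in> set (vwalk_arcs p)" by auto
    then have "rev p \<in> terminal_paths S" "(b, a) \<in> set (vwalk_arcs (rev p))"
      by (auto simp: terminal_paths_rev set_vwalk_arcs_rev)
    then show "(b, a) \<in> arcs_ends (with_proj (path_hull S))" by auto
  qed
  show "fst e \<noteq> snd e" if "e \<in> parcs (path_hull S)" for e
  proof -
    have "e \<in> parcs T"
      using that by (auto simp: terminal_paths_def vpath_def vwalk_def)
    then show ?thesis by (rule pair_no_loops)
  qed
qed

lemma subgraph_path_hull: "subgraph (with_proj (path_hull S)) (with_proj T)"
proof (rule subgraphI)
  interpret H: pair_bidirected_digraph "path_hull S"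
    by (rule pair_bidirected_digraph_path_hull)
  show "wf_digraph (with_proj (path_hull S))" by unfold_locales
  show "wf_digraph (with_proj T)" by unfold_locales
qed (auto simp: terminal_paths_def vpath_def vwalk_def)

text \<open>Terminals reach each other along terminal paths, and any other vertex is reached from a
  terminal by a prefix of the path on which it lies; symmetry does the rest.\<close>

lemma connected_path_hull:
  assumes "S \<subseteq> pverts T" "S \<noteq> {}"
  shows "connected (with_proj (path_hull S))"
proof -
  interpret H: pair_bidirected_digraph "path_hull S"
    by (rule pair_bidirected_digraph_path_hull)
  let ?H = "with_proj (path_hull S)"
  have walk: "vwalk p ?H" if "p \<in> terminal_paths S" for p
    using that by (auto simp: vwalk_def terminal_paths_def vpath_def)
  have terminals: "u \<rightarrow>\<^sup>*\<^bsub>?H\<^esub> v" if uv: "u \<in> S" "v \<in> S" for u v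
  proof -
    obtain p where p: "vpath p (with_proj T)" "hd p = u" "last p = v"
      using ex_vpath[of u v] assms uv by blast
    then have "vwalk p ?H"
      using walk uv by (auto simp: terminal_paths_def)
    then show ?thesis
      using p by (auto simp: H.reachable_vwalk_conv)
  qed
  have to_terminal: "\<exists>u\<in>S. u \<rightarrow>\<^sup>*\<^bsub>?H\<^esub> x" if "x \<in> pverts (path_hull S)" for x
  proof -
    from that obtain p where p: "p \<in> terminal_paths S" "x \<in> set p" by auto
    from p(2) obtain p1 p2 where split: "p = p1 @ x # p2" by (meson split_list)
    then have "vwalk ((p1 @ [x]) @ p2) ?H" using walk[OF p(1)] by simp
    then have "vwalk (p1 @ [x]) ?H" by (rule vwalkI_append_l[rotated]) simp
    then have "hd (p1 @ [x]) \<rightarrow>\<^sup>*\<^bsub>?H\<^esub> x"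
      by (subst H.reachable_vwalk_conv) (metis last_snoc)
    moreover have "hd (p1 @ [x]) \<in> S"
      using p split by (cases p1) (auto simp: terminal_paths_def)
    ultimately show ?thesis by blast
  qed
  have "x \<rightarrow>\<^sup>*\<^bsub>?H\<^esub> y" if x: "x \<in> pverts (path_hull S)" and y: "y \<in> pverts (path_hull S)" for x y
    using to_terminal[OF x] to_terminal[OF y] terminals
      H.reachable_trans H.symmetric_reachable' by meson
  moreover obtain u where "u \<in> S" using assms by blast
  then have "pverts (path_hull S) \<noteq> {}"
    using H.reachable_in_verts(1)[OF terminals[of u u]] by blast
  ultimately show ?thesis
    by (intro H.connectedI)
      (simp_all only: H.reachable_mk_symmetric_eq[OF H.sym_arcs] with_proj_simps not_False_eq_True)
qed

lemma connected_subgraph_containing_path_hull: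
  assumes "S \<subseteq> pverts T" "S \<noteq> {}"
  shows "connected_subgraph_containing T S (path_hull S)"
proof -
  have "S \<subseteq> pverts (path_hull S)"
    using singleton_terminal_path[OF assms(1)] by force
  then show ?thesis
    unfolding connected_subgraph_containing_def
    using pair_bidirected_digraph_path_hull subgraph_path_hull connected_path_hull[OF assms]
    by blast
qed

text \<open>A path in \<open>K\<close> between two terminals is also a path in \<open>T\<close>,
  hence by uniqueness the terminal path itself. So \<open>K\<close> contains every terminal
  path.\<close>

lemma path_hull_least:
  assumes "connected_subgraph_containing T S K"
  shows "subgraph (with_proj (path_hull S)) (with_proj K)"
proof -
  interpret K: pair_bidirected_digraph K
    using assms by (simp add: connected_subgraph_containing_def)
  interpret H: pair_bidirected_digraph "path_hull S"
    by (rule pair_bidirected_digraph_path_hull)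
  have "strongly_connected (with_proj K)"
    using assms K.symmetric_connected_imp_strongly_connected[OF K.sym_arcs]
    by (simp add: connected_subgraph_containing_def)
  then have reach: "u \<rightarrow>\<^sup>*\<^bsub>with_proj K\<^esub> v" if "u \<in> S" "v \<in> S" for u v
    using that assms by (auto simp: connected_subgraph_containing_def strongly_connected_def)
  have "vwalk p (with_proj K)" if p: "p \<in> terminal_paths S" for p
  proof -
    obtain q where q: "vpath q (with_proj K)" "hd q = hd p" "last q = last p"
      using reach[of "hd p" "last p"] p by (auto simp: terminal_paths_def K.reachable_vpath_conv)
    moreover have "vpath q (with_proj T)"
      using q assms vpathI_subgraph by (auto simp: connected_subgraph_containing_def)
    ultimately have "q = p"
      using p vpath_unique by (auto simp: terminal_paths_def)
    with q show ?thesis by auto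
  qed
  then have "pverts (path_hull S) \<subseteq> pverts K" "parcs (path_hull S) \<subseteq> parcs K"
    by (auto simp: vwalk_def)
  then show ?thesis
    by (intro subgraphI) (auto, unfold_locales)
qed

text \<open>A least element is the only minimal one, which also makes the definite description well
  defined.\<close>

lemma steiner_subtree_eq_path_hull:
  assumes "S \<subseteq> pverts T" "S \<noteq> {}"
  shows "steiner_subtree T S = path_hull S"
  unfolding steiner_subtree_def
proof (rule the_equality)
  show "is_steiner_subtree T S (path_hull S)"
    using connected_subgraph_containing_path_hull[OF assms] path_hull_least
      subgraph_with_proj_antisym
    by (auto simp: is_steiner_subtree_def)
  show "K = path_hull S" if "is_steiner_subtree T S K" for K
    using that connected_subgraph_containing_path_hull[OF assms] path_hull_least
    by (auto simp: is_steiner_subtree_def)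
qed

section \<open>Leaves of the Steiner subtree\<close>

text \<open>This covers infinite degrees as well: \<open>card\<close> of an infinite set is 0, so
  the value 1 always means exactly one neighbour.\<close>

lemma out_degree_path_hull_eq_1_iff:
  "out_degree (with_proj (path_hull S)) v = 1 \<longleftrightarrow> (\<exists>!w. (v, w) \<in> parcs (path_hull S))"
proof -
  have "out_arcs (with_proj (path_hull S)) v = Pair v ` {w. (v, w) \<in> parcs (path_hull S)}"
    by auto
  then have "out_degree (with_proj (path_hull S)) v = card {w. (v, w) \<in> parcs (path_hull S)}"
    by (simp add: out_degree_def card_image inj_on_def)
  also have "\<dots> = 1 \<longleftrightarrow> (\<exists>w. {w. (v, w) \<in> parcs (path_hull S)} = {w})"
    by (simp add: card_1_singleton_iff)
  also have "\<dots> \<longleftrightarrow> (\<exists>!w. (v, w) \<in> parcs (path_hull S))"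
    by (simp only: set_eq_iff mem_Collect_eq singleton_iff) metis
  finally show ?thesis .
qed

lemma internal_vertex_not_leaf:
  assumes "p \<in> terminal_paths S" "v \<in> set (butlast (tl p))"
  shows "v \<notin> leaves (path_hull S)"
proof -
  obtain u r where p: "p = u # r" using assms by (cases p) auto
  then have "r \<noteq> []" "v \<in> set (butlast r)" using assms by auto
  then obtain xs ys where "butlast r = xs @ v # ys" by (meson split_list)
  then have split: "p = (u # xs) @ v # ys @ [last r]"
    using p \<open>r \<noteq> []\<close> by (metis append_Cons append.assoc append_butlast_last_id)
  \<comment> \<open>The predecessor and the successor of \<open>v\<close> on
    \<open>p\<close>.\<close>
  define a b where "a = last (u # xs)" and "b = hd (ys @ [last r])"
  have "p = butlast (u # xs) @ a # v # ys @ [last r]"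
    using split by (metis a_def append_butlast_last_id append_Cons append_Nil append.assoc list.distinct(1))
  moreover have "p = (u # xs) @ v # b # tl (ys @ [last r])"
    using split by (simp add: b_def)
  ultimately have arcs: "(a, v) \<in> set (vwalk_arcs p)" "(v, b) \<in> set (vwalk_arcs p)"
    unfolding in_set_vwalk_arcs_iff by blast+
  have "distinct p"
    using assms by (auto simp: terminal_paths_def)
  moreover have "a \<in> set (u # xs)" "b \<in> set (ys @ [last r])"
    unfolding a_def b_def by (rule last_in_set, simp, rule hd_in_set, simp)
  ultimately have "a \<noteq> b" "a \<noteq> v"
    using split by auto
  interpret H: pair_bidirected_digraph "path_hull S"
    by (rule pair_bidirected_digraph_path_hull)
  have "(v, a) \<in> parcs (path_hull S)" "(v, b) \<in> parcs (path_hull S)"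
    using arcs assms(1) H.arcs_symmetric[of a v] by auto
  \<comment> \<open>The second fact, with \<open>a \<noteq> v\<close>, excludes the one-vertex
    clause of \<open>leaves\<close>.\<close>
  then have "out_degree (with_proj (path_hull S)) v \<noteq> 1" "a \<in> pverts (path_hull S)"
    using \<open>a \<noteq> b\<close> out_degree_path_hull_eq_1_iff H.in_arcsD2 by blast+
  then show ?thesis
    using \<open>a \<noteq> v\<close> by (auto simp: leaves_def)
qed

lemma leaves_path_hull_subset: "leaves (path_hull S) \<subseteq> S"
proof
  fix v assume v: "v \<in> leaves (path_hull S)"
  then obtain p where p: "p \<in> terminal_paths S" "v \<in> set p"
    by (auto simp: leaves_def)
  then have "v \<notin> set (butlast (tl p))"
    using internal_vertex_not_leaf v by blast
  then have "v = hd p \<or> v = last p"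
    using p(2) by (cases p; cases "tl p" rule: rev_cases) auto
  then show "v \<in> S" using p by (auto simp: terminal_paths_def)
qed

lemma terminal_leaf:
  assumes "S \<subseteq> pverts T" "v \<in> S"
    and free: "\<forall>p\<in>terminal_paths S. v \<notin> set (butlast (tl p))"
  shows "v \<in> leaves (path_hull S)"
proof -
  have v: "[v] \<in> terminal_paths S"
    using assms(1,2) by (rule singleton_terminal_path)
  show ?thesis
  proof (cases "S = {v}")
    case True
    \<comment> \<open>The hull consists of \<open>v\<close> alone, a leaf by the one-vertex
      convention.\<close>
    have "p = [v]" if "p \<in> terminal_paths S" for p
      using that v True vpath_unique[of p "[v]"] by (auto simp: terminal_paths_def)
    then have "terminal_paths S = {[v]}" using v by blast
    then show ?thesis by (simp add: leaves_def)
  next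
    case False
    then obtain w where w: "w \<in> S" "w \<noteq> v" using assms(2) by blast
    obtain p where p: "vpath p (with_proj T)" "hd p = v" "last p = w"
      using ex_vpath[of v w] assms(1,2) w(1) by blast
    then obtain a r where "p = v # a # r"
      using w by (cases p; cases "tl p") (auto simp: vpath_def vwalk_def)
    moreover have "p \<in> terminal_paths S"
      using p w assms by (auto simp: terminal_paths_def)
    moreover have "(v, a) \<in> set (vwalk_arcs (v # a # r))" by simp
    ultimately have ex: "(v, a) \<in> parcs (path_hull S)" unfolding path_hull_simps by blast
    \<comment> \<open>A path through this arc has \<open>c\<close> after \<open>v\<close>; any
      vertex before \<open>v\<close> would make \<open>v\<close> internal.\<close>
    have start: "\<exists>r. v # c # r \<in> terminal_paths S" if "(v, c) \<in> parcs (path_hull S)" for c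
    proof -
      from that obtain xs r where q: "xs @ v # c # r \<in> terminal_paths S"
        by (auto simp: in_set_vwalk_arcs_iff)
      have "xs = []"
      proof (rule ccontr)
        assume "xs \<noteq> []"
        then have "v \<in> set (butlast (tl (xs @ v # c # r)))"
          by (simp add: butlast_append)
        with free q show False by blast
      qed
      with q show ?thesis by auto
    qed
    have "b = c" if bc: "(v, b) \<in> parcs (path_hull S)" "(v, c) \<in> parcs (path_hull S)" for b c
    proof (rule ccontr)
      assume "b \<noteq> c"
      obtain q r where q: "v # b # q \<in> terminal_paths S" and r: "v # c # r \<in> terminal_paths S"
        using start bc by blast
      \<comment> \<open>Back along the first path to \<open>v\<close>, then out along the second: a
        path between terminals, as the two meet only in \<open>v\<close>, and with \<open>v\<close>
        internal.\<close>
      let ?s = "rev (b # q) @ v # c # r"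
      have disj: "set (b # q) \<inter> set (c # r) = {}"
        using diverging_paths_meet_only_at_start[of v "b # q" "c # r"] q r \<open>b \<noteq> c\<close>
        by (simp add: terminal_paths_def)
      have "vwalk (rev (v # b # q)) (with_proj T)"
        using terminal_paths_rev[OF q] by (auto simp: terminal_paths_def)
      moreover have "vwalk (v # c # r) (with_proj T)"
        using r by (auto simp: terminal_paths_def)
      ultimately have "vwalk (rev (v # b # q) \<oplus> (v # c # r)) (with_proj T)"
        by (rule vwalk_joinI_vwalk') simp
      then have "vpath ?s (with_proj T)"
        using q r disj by (auto simp: vwalk_join_def terminal_paths_def vpath_def)
      then have "?s \<in> terminal_paths S"
        using q r by (auto simp: terminal_paths_def hd_append hd_rev)
      moreover have "v \<in> set (butlast (tl ?s))"
        by (cases "rev (b # q)") (auto simp: butlast_append)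
      ultimately show False using free by blast
    qed
    with ex have "\<exists>!c. (v, c) \<in> parcs (path_hull S)" by blast
    moreover have "v \<in> pverts (path_hull S)" using v by force
    ultimately show ?thesis
      using out_degree_path_hull_eq_1_iff by (simp add: leaves_def)
  qed
qed

end

theorem lemma1:
  fixes T :: "'a pair_pre_digraph" and S :: "'a set"
  assumes "undirected_tree T"
    and "S \<subseteq> pverts T"
    and "S \<noteq> {}"
  shows "mutual_visibility_set T S \<longleftrightarrow> S = leaves (steiner_subtree T S)"
proof -
  interpret undirected_tree_graph T
    by unfold_locales fact
  \<comment> \<open>The leaves always lie in \<open>S\<close>. If no terminal is internal,
    \<open>terminal_leaf\<close> gives the other inclusion; conversely, an internal terminal would
    be a non-leaf in \<open>S\<close>.\<close>
  have "(\<forall>p\<in>terminal_paths S. set (butlast (tl p)) \<inter> S = {}) \<longleftrightarrow> S = leaves (path_hull S)"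
    using internal_vertex_not_leaf leaves_path_hull_subset terminal_leaf[OF assms(2)] by blast
  then show ?thesis
    using mutual_visibility_set_iff steiner_subtree_eq_path_hull assms by simp
qed

end
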